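(* The map $\iota_c:\mathrm{Cyl}_S^*\to\underline{\mathrm{Cyl}}^*$ intertwines the (dual actions of the) functions of finitely many holonomies along straight edges. That is, let $F:\mathcal{A}\to\mathbb{C}$ be any function in $\underline{\mathrm{Cyl}}$, i.e. $F(A)=\tilde F(A(e_1),\dots,A(e_n))$ with $e_1,\dots,e_n$ straight edges and $\tilde F:\mathrm{SU}(2)^n\to\mathbb{C}$ real analytic. Then $$F(\hat A)^*\circ\iota_c=\iota_c\circ F(r(\hat c))^*$$ as maps $\mathrm{Cyl}_S^*\to\underline{\mathrm{Cyl}}^*$.
   Context: **Connections and symmetric connections.** $M$ is the spatial 3-manifold with a fixed (analytic) action $(x,\rho)\mapsto\phi_{(x,\rho)}$ of the Euclidean group $\mathscr{E}=\mathbb{R}^3\rtimes\mathrm{SO}(3)$ (spatially flat case: $M\cong\mathbb{R}^3$ with the standard action). $\mathcal{A}$ is the space of smooth $\mathrm{SU}(2)$ connections $A=A^i_a$ on $M$ (components with respect to the basis $\tau_i=-\frac{i}{2}\sigma_i$ of $\mathfrak{su}(2)$, $\sigma_i$ the Pauli matrices). $\mathscr{E}$ acts on $\mathcal{A}$ by $((x,\rho)\cdot A)^i_a=\rho^i{}_j\,(\phi_{(x,\rho)})_*A^j_a$. The space $\mathcal{A}_S\subset\mathcal{A}$ of invariant connections is one-dimensional, $\mathcal{A}_S=\{c\,\mathring{A}: c\in\mathbb{R}\}$, where $\mathring{A}\in\mathcal{A}_S$ is a fixed nonzero reference connection. Fix a length $\ell_o>0$ and the triad $\mathring{e}^a_i$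 with $\mathring{e}^a_i\mathring{A}^j_a=\ell_o^{-1}\delta^j_i$; let $\mathring{q}_{ab}$ be the (flat) metric determined by $\mathring{e}^a_i$. (For the standard action on $\mathbb{R}^3$, $\mathring{A}^i_a=\ell_o^{-1}\delta^i_a$ up to scale.) **Cylindrical functions.** $A(e)\in\mathrm{SU}(2)$ denotes the holonomy of $A$ along a curve $e$. An edge is straight if it is a straight (geodesic) segment with respect to $\mathring{q}$. $\underline{\mathrm{Cyl}}$ is the space of functions $\Phi:\mathcal{A}\to\mathbb{C}$ of the form $\Phi(A)=f(A(e_1),\dots,A(e_n))$ with $n$ finite, $e_1,\dots,e_n$ straight edges, and $f:\mathrm{SU}(2)^n\to\mathbb{C}$ real analytic. Let $r:\mathbb{R}\to\mathcal{A}$, $r(c)=c\,\mathring{A}$, and $\mathrm{Cyl}_S:=r^*[\underline{\mathrm{Cyl}}]$, a space of functions $\mathbb{R}\to\mathbb{C}$. $\underline{\mathrm{Cyl}}^*$ and $\mathrm{Cyl}_S^*$ denote algebraic duals; evaluation of $(\psi|$ on a test function $\phi$ is written $(\psi|\phi\rangle$. **The c-embedding.** $\iota_c:\mathrm{Cyl}_S^*\to\underline{\mathrm{Cyl}}^*$ is defined by $\iota_c[(\psi|]\,|\Phi\rangle:=(\psi|r^*\Phi\rangle$ for $\Phi\in\underline{\mathrm{Cyl}}$. **Operators.** $F(\hat A)$ is the operator on $\underline{\mathrm{Cyl}}$ of multiplication by $F$; $F(r(\hat c))$ is the operator on $\mathrm{Cyl}_S$ of multiplication by the function $c\mapsto F(r(c))$.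 For an operator $O$ on a vector space $W$, $O^*$ denotes its dual action on the algebraic dual $W^*$: $(O^*\psi)(\phi)=\psi(O\phi)$. *)

theory Defs
  imports "HOL-Analysis.Analysis"
begin

definition pauli :: "3 \<Rightarrow> complex^2^2" where
  "pauli i =
     (if i = 1 then vector [vector [0, 1], vector [1, 0]]
      else if i = 2 then vector [vector [0, - \<i>], vector [\<i>, 0]]
      else vector [vector [1, 0], vector [0, - 1]])"

definition tau :: "3 \<Rightarrow> complex^2^2" where
  "tau i = (\<chi> r s. - (\<i> / 2) * pauli i $ r $ s)"

definition su2_elem :: "real^3 \<Rightarrow> complex^2^2" where
  "su2_elem v = (\<Sum>i\<in>UNIV. (v $ i) *\<^sub>R tau i)"

definition adjoint_mat :: "complex^2^2 \<Rightarrow> complex^2^2" where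
  "adjoint_mat U = (\<chi> r s. cnj (U $ s $ r))"

definition SU2 :: "(complex^2^2) set" where
  "SU2 = {U. adjoint_mat U ** U = mat 1 \<and> det U = 1}"

text \<open>The product \<open>*\<close> on \<^typ>\<open>complex^2^2\<close> is componentwise, so the library's \<open>exp\<close> is not
  the matrix exponential.\<close>

definition mat_exp :: "complex^2^2 \<Rightarrow> complex^2^2" where
  "mat_exp X = (\<Sum>k. (1 / fact k) *\<^sub>R (((**) X ^^ k) (mat 1)))"

text \<open>\<open>g\<close> is, near the origin of \<open>\<real>\<^sup>I\<close> (\<open>I\<close> finite), the sum of a power series. Multi-indices
  are functions \<open>\<alpha>\<close> supported in \<open>I\<close>.\<close>

definition analytic_at_origin :: "'i set \<Rightarrow> (('i \<Rightarrow> real) \<Rightarrow> complex) \<Rightarrow> bool" where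
  "analytic_at_origin I g \<longleftrightarrow>
     (\<exists>r>0. \<exists>a :: ('i \<Rightarrow> nat) \<Rightarrow> complex.
        \<forall>x. (\<forall>i\<in>I. \<bar>x i\<bar> < r) \<longrightarrow>
          ((\<lambda>\<alpha>. a \<alpha> * complex_of_real (\<Prod>i\<in>I. x i ^ \<alpha> i)) has_sum g x)
            {\<alpha>. \<forall>i. i \<notin> I \<longrightarrow> \<alpha> i = 0})"

text \<open>\<open>SU(2)\<^sup>n\<close> is \<open>{..<n} \<rightarrow>\<^sub>E SU2\<close>. Analyticity at \<open>g\<close> is tested in the exponential chart
  \<open>x \<mapsto> (g\<^sub>k exp(\<Sum>\<^sub>i x\<^sub>k\<^sub>i \<tau>\<^sub>i))\<^sub>k\<close> centred at \<open>g\<close>; these charts form an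
  analytic atlas of the Lie group.\<close>

definition real_analytic_SU2 :: "nat \<Rightarrow> ((nat \<Rightarrow> complex^2^2) \<Rightarrow> complex) \<Rightarrow> bool" where
  "real_analytic_SU2 n f \<longleftrightarrow>
     (\<forall>g \<in> {..<n} \<rightarrow>\<^sub>E SU2.
        analytic_at_origin ({..<n} \<times> (UNIV :: 3 set))
          (\<lambda>x. f (\<lambda>k\<in>{..<n}. g k ** mat_exp (su2_elem (\<chi> i. x (k, i))))))"

primrec times_differentiable ::
  "nat \<Rightarrow> ('a::real_normed_vector \<Rightarrow> 'b::real_normed_vector) \<Rightarrow> bool" where
  "times_differentiable 0 f \<longleftrightarrow> continuous_on UNIV f"
| "times_differentiable (Suc k) f \<longleftrightarrow>
     (\<forall>x. f differentiable at x) \<and>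
     (\<forall>v. times_differentiable k (\<lambda>x. frechet_derivative f (at x) v))"

definition smooth :: "('a::real_normed_vector \<Rightarrow> 'b::real_normed_vector) \<Rightarrow> bool" where
  "smooth f \<longleftrightarrow> (\<forall>k. times_differentiable k f)"

lemma times_differentiable_zero:
  "times_differentiable k (\<lambda>x::'a::real_normed_vector. 0::'b::real_normed_vector)"
  by (induction k) auto

lemma times_differentiable_add:
  fixes f g :: "'a::real_normed_vector \<Rightarrow> 'b::real_normed_vector"
  assumes "times_differentiable k f" "times_differentiable k g"
  shows "times_differentiable k (\<lambda>x. f x + g x)"
  using assms
proof (induction k arbitrary: f g)
  case 0
  then show ?case by (auto intro: continuous_on_add)
next
  case (Suc k)
  have "frechet_derivative (\<lambda>x. f x + g x) (at x) =
      (\<lambda>v. frechet_derivative f (at x) v + frechet_derivative g (at x) v)" for x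
    using Suc.prems
    by (intro frechet_derivative_at[symmetric] has_derivative_add)
      (auto simp: frechet_derivative_works)
  then show ?case
    using Suc by (auto intro: differentiable_add)
qed

lemma times_differentiable_scaleR:
  fixes f :: "'a::real_normed_vector \<Rightarrow> 'b::real_normed_vector"
  assumes "times_differentiable k f"
  shows "times_differentiable k (\<lambda>x. c *\<^sub>R f x)"
  using assms
proof (induction k arbitrary: f)
  case 0
  then show ?case by (auto intro: continuous_intros)
next
  case (Suc k)
  have "frechet_derivative (\<lambda>x. c *\<^sub>R f x) (at x) =
      (\<lambda>v. c *\<^sub>R frechet_derivative f (at x) v)" for x
    using Suc.prems
    by (intro frechet_derivative_at[symmetric] has_derivative_scaleR_right)
      (auto simp: frechet_derivative_works)
  then show ?case
    using Suc by (auto intro: differentiable_scaleR)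
qed

text \<open>A connection on \<open>M = \<real>\<^sup>3\<close> is given by its components:
  \<open>A\<^sup>i\<^sub>a(p) = connection_form A p $ i $ a\<close>.\<close>

typedef connection = "{A :: real^3 \<Rightarrow> real^3^3. smooth A}"
  morphisms connection_form Abs_connection
  by (rule exI[of _ "\<lambda>_. 0"]) (simp add: smooth_def times_differentiable_zero)

setup_lifting type_definition_connection

instantiation connection :: real_vector
begin

lift_definition zero_connection :: connection is "\<lambda>_. 0"
  by (simp add: smooth_def times_differentiable_zero)

lift_definition plus_connection :: "connection \<Rightarrow> connection \<Rightarrow> connection"
  is "\<lambda>A B p. A p + B p"
  by (simp add: smooth_def times_differentiable_add)

lift_definition scaleR_connection :: "real \<Rightarrow> connection \<Rightarrow> connection"
  is "\<lambda>c A p. c *\<^sub>R A p"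
  by (simp add: smooth_def times_differentiable_scaleR)

definition uminus_connection :: "connection \<Rightarrow> connection" where
  "uminus_connection A = (-1) *\<^sub>R A"

definition minus_connection :: "connection \<Rightarrow> connection \<Rightarrow> connection" where
  "minus_connection A B = A + (-1) *\<^sub>R B"

instance
  by standard
    (unfold uminus_connection_def minus_connection_def, (transfer; simp add: algebra_simps fun_eq_iff)+)

end

definition euclid_map :: "real^3 \<Rightarrow> real^3^3 \<Rightarrow> real^3 \<Rightarrow> real^3" where
  "euclid_map x \<rho> p = x + \<rho> *v p"

text \<open>Push-forward of the three one-forms \<open>A\<^sup>j\<close> (the rows of \<open>A\<close>) under a diffeomorphism
  \<open>\<phi>\<close>: \<open>(\<phi>\<^sub>* A\<^sup>j)\<^sub>p(v) = A\<^sup>j\<^bsub>\<phi>\<^sup>-\<^sup>1 p\<^esub>(D(\<phi>\<^sup>-\<^sup>1)\<^sub>p v)\<close>.\<close>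

definition push_forward ::
  "(real^3 \<Rightarrow> real^3) \<Rightarrow> (real^3 \<Rightarrow> real^3^3) \<Rightarrow> real^3 \<Rightarrow> real^3^3" where
  "push_forward \<phi> A p = A (inv \<phi> p) ** matrix (frechet_derivative (inv \<phi>) (at p))"

definition euclid_act ::
  "real^3 \<Rightarrow> real^3^3 \<Rightarrow> (real^3 \<Rightarrow> real^3^3) \<Rightarrow> real^3 \<Rightarrow> real^3^3" where
  "euclid_act x \<rho> A p = \<rho> ** push_forward (euclid_map x \<rho>) A p"

definition invariant_connections :: "connection set" where
  "invariant_connections =
     {A. \<forall>x \<rho>. rotation_matrix \<rho> \<longrightarrow>
           euclid_act x \<rho> (connection_form A) = connection_form A}"

text \<open>A triad is written \<open>e\<^sup>a\<^sub>i(p) = e p $ a $ i\<close>. The metric for which it is orthonormal is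
  \<open>q\<^sub>a\<^sub>b = \<Sum>\<^sub>i \<theta>\<^sup>i\<^sub>a \<theta>\<^sup>i\<^sub>b\<close>, where \<open>\<theta>\<close> is the dual cotriad.\<close>

definition triad_metric :: "(real^3 \<Rightarrow> real^3^3) \<Rightarrow> real^3 \<Rightarrow> real^3^3" where
  "triad_metric e p = transpose (matrix_inv (e p)) ** matrix_inv (e p)"

text \<open>\<open>partial_metric q p a b c = \<partial>\<^sub>a q\<^sub>b\<^sub>c(p)\<close>\<close>

definition partial_metric :: "(real^3 \<Rightarrow> real^3^3) \<Rightarrow> real^3 \<Rightarrow> 3 \<Rightarrow> 3 \<Rightarrow> 3 \<Rightarrow> real" where
  "partial_metric q p a b c = frechet_derivative (\<lambda>y. q y $ b $ c) (at p) (axis a 1)"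

definition christoffel :: "(real^3 \<Rightarrow> real^3^3) \<Rightarrow> real^3 \<Rightarrow> 3 \<Rightarrow> 3 \<Rightarrow> 3 \<Rightarrow> real" where
  "christoffel q p c a b =
     (1 / 2) * (\<Sum>d\<in>UNIV. matrix_inv (q p) $ c $ d *
       (partial_metric q p a b d + partial_metric q p b a d - partial_metric q p d a b))"

text \<open>Edges are parametrised affinely by \<open>[0,1]\<close>; values outside this interval are irrelevant.\<close>

definition straight_edge :: "(real^3 \<Rightarrow> real^3^3) \<Rightarrow> (real \<Rightarrow> real^3) \<Rightarrow> bool" where
  "straight_edge q \<gamma> \<longleftrightarrow>
     (\<exists>u. \<forall>t\<in>{0..1}.
        (\<gamma> has_vector_derivative u t) (at t within {0..1}) \<and> u t \<noteq> 0 \<and>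
        (u has_vector_derivative
           (\<chi> c. - (\<Sum>a\<in>UNIV. \<Sum>b\<in>UNIV. christoffel q (\<gamma> t) c a b * u t $ a * u t $ b)))
          (at t within {0..1}))"

text \<open>The path-ordered exponential \<open>P exp \<integral>\<^sub>\<gamma> A = h(1)\<close>, where
  \<open>h' = h A(\<gamma>')\<close> and \<open>h(0) = 1\<close>.\<close>

definition holonomy :: "connection \<Rightarrow> (real \<Rightarrow> real^3) \<Rightarrow> complex^2^2" where
  "holonomy A \<gamma> =
     (THE g. \<exists>h. h 0 = mat 1 \<and> h 1 = g \<and>
        (\<forall>t\<in>{0..1}.
           (h has_vector_derivative
              h t ** su2_elem (connection_form A (\<gamma> t) *v
                                vector_derivative \<gamma> (at t within {0..1})))
             (at t within {0..1})))"

definition Cyl :: "(real^3 \<Rightarrow> real^3^3) \<Rightarrow> (connection \<Rightarrow> complex) set" where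
  "Cyl q = {\<Phi>. \<exists>n \<gamma> f.
     (\<forall>k<n. straight_edge q (\<gamma> k)) \<and> real_analytic_SU2 n f \<and>
     (\<forall>A. \<Phi> A = f (\<lambda>k\<in>{..<n}. holonomy A (\<gamma> k)))}"

definition symm_conn :: "connection \<Rightarrow> real \<Rightarrow> connection" where
  "symm_conn A0 c = c *\<^sub>R A0"

definition pull_back :: "connection \<Rightarrow> (connection \<Rightarrow> complex) \<Rightarrow> real \<Rightarrow> complex" where
  "pull_back A0 \<Phi> = \<Phi> \<circ> symm_conn A0"

definition Cyl_S :: "(real^3 \<Rightarrow> real^3^3) \<Rightarrow> connection \<Rightarrow> (real \<Rightarrow> complex) set" where
  "Cyl_S q A0 = pull_back A0 ` Cyl q"

text \<open>Linear functionals on a space \<open>W\<close> of complex-valued functions are taken to be extensional,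
  so that two of them are equal as soon as they agree on \<open>W\<close>.\<close>

definition algebraic_dual ::
  "('x \<Rightarrow> complex) set \<Rightarrow> (('x \<Rightarrow> complex) \<Rightarrow> complex) set" where
  "algebraic_dual W =
     {\<psi> \<in> extensional W.
        (\<forall>\<phi>\<in>W. \<forall>\<eta>\<in>W. \<psi> (\<lambda>x. \<phi> x + \<eta> x) = \<psi> \<phi> + \<psi> \<eta>) \<and>
        (\<forall>a. \<forall>\<phi>\<in>W. \<psi> (\<lambda>x. a * \<phi> x) = a * \<psi> \<phi>)}"

definition dual_action ::
  "('x \<Rightarrow> complex) set \<Rightarrow> (('x \<Rightarrow> complex) \<Rightarrow> ('x \<Rightarrow> complex)) \<Rightarrow>
   (('x \<Rightarrow> complex) \<Rightarrow> complex) \<Rightarrow> (('x \<Rightarrow> complex) \<Rightarrow> complex)" where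
  "dual_action W T \<psi> = (\<lambda>\<phi>\<in>W. \<psi> (T \<phi>))"

definition mult_op :: "('x \<Rightarrow> complex) \<Rightarrow> ('x \<Rightarrow> complex) \<Rightarrow> ('x \<Rightarrow> complex)" where
  "mult_op F \<phi> = (\<lambda>x. F x * \<phi> x)"

definition c_embedding ::
  "(real^3 \<Rightarrow> real^3^3) \<Rightarrow> connection \<Rightarrow>
   ((real \<Rightarrow> complex) \<Rightarrow> complex) \<Rightarrow> ((connection \<Rightarrow> complex) \<Rightarrow> complex)" where
  "c_embedding q A0 \<psi> = (\<lambda>\<Phi>\<in>Cyl q. \<psi> (pull_back A0 \<Phi>))"

end

theory Submission
  imports Defs
begin

text \<open>Pulling back along \<open>r\<close> is multiplicative, so both sides send \<open>\<psi>\<close> to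
  \<open>\<Phi> \<mapsto> \<psi> (r\<^sup>* (F \<Phi>))\<close>. What needs an argument is that \<open>F \<Phi>\<close> is cylindrical again:
  the edges of \<open>F\<close> and \<open>\<Phi>\<close> are concatenated, and the product of the two power series is a
  power series in the disjoint union of the variables.\<close>

text \<open>Iterated summation gives the value: the inner sum over \<open>B\<close> is
  \<open>f x * t\<close>, the outer one \<open>s * t\<close>. Summability of the whole family over
  \<open>A \<times> B\<close> has to be shown separately.\<close>

lemma has_sum_product:
  fixes f :: "'a \<Rightarrow> complex" and g :: "'b \<Rightarrow> complex"
  assumes f: "(f has_sum s) A" and g: "(g has_sum t) B"
  shows "((\<lambda>(x, y). f x * g y) has_sum (s * t)) (A \<times> B)"
proof (rule has_sum_SigmaI)
  show "((\<lambda>y. case (x, y) of (x, y) \<Rightarrow> f x * g y) has_sum (f x * t)) B" for x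
    using has_sum_cmult_right[OF g, of "f x"] by simp
  show "((\<lambda>x. f x * t) has_sum (s * t)) A"
    by (rule has_sum_cmult_left[OF f])
  \<comment> \<open>For complex families unconditional and absolute summability coincide, and norms
    of products factor, so summability over the product reduces to that of the two factors.\<close>
  have "(\<lambda>x. norm (f x)) summable_on A" "(\<lambda>y. norm (g y)) summable_on B"
    using f g by (auto simp: summable_on_iff_abs_summable_on_complex[symmetric] summable_on_def)
  then have "(\<lambda>p. norm (case p of (x, y) \<Rightarrow> f x * g y)) summable_on A \<times> B"
    by (auto simp: Infinite_Sum.abs_summable_on_Sigma_iff norm_mult infsum_cmult_right' abs_mult
        intro!: summable_on_cmult_right summable_on_cmult_left)
  then show "(\<lambda>(x, y). f x * g y) summable_on A \<times> B"
    by (simp add: summable_on_iff_abs_summable_on_complex)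
qed

text \<open>All coefficients vanish except the one at the zero multi-index, whose monomial is
  1.\<close>

lemma analytic_at_origin_const:
  assumes "finite I"
  shows "analytic_at_origin I (\<lambda>_. c)"
proof -
  have "((\<lambda>\<alpha>. (if \<alpha> = (\<lambda>_. 0) then c else 0) * complex_of_real (\<Prod>i\<in>I. x i ^ \<alpha> i)) has_sum c)
          {\<alpha>. \<forall>i. i \<notin> I \<longrightarrow> \<alpha> i = 0}" for x
    by (rule has_sum_finite_neutralI[of "{\<lambda>_. 0}"]) auto
  then show ?thesis
    unfolding analytic_at_origin_def
    by (intro exI[of _ 1] conjI exI[of _ "\<lambda>\<alpha>. if \<alpha> = (\<lambda>_. 0) then c else 0"]) auto
qed

lemma analytic_at_origin_add:
  assumes "analytic_at_origin I g" "analytic_at_origin I h"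
  shows "analytic_at_origin I (\<lambda>x. g x + h x)"
proof -
  obtain r a where r: "r > 0"
    and a: "\<And>x. \<forall>i\<in>I. \<bar>x i\<bar> < r \<Longrightarrow>
      ((\<lambda>\<alpha>. a \<alpha> * complex_of_real (\<Prod>i\<in>I. x i ^ \<alpha> i)) has_sum g x) {\<alpha>. \<forall>i. i \<notin> I \<longrightarrow> \<alpha> i = 0}"
    using assms(1) unfolding analytic_at_origin_def by blast
  obtain s b where s: "s > 0"
    and b: "\<And>x. \<forall>i\<in>I. \<bar>x i\<bar> < s \<Longrightarrow>
      ((\<lambda>\<alpha>. b \<alpha> * complex_of_real (\<Prod>i\<in>I. x i ^ \<alpha> i)) has_sum h x) {\<alpha>. \<forall>i. i \<notin> I \<longrightarrow> \<alpha> i = 0}"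
    using assms(2) unfolding analytic_at_origin_def by blast
  have "((\<lambda>\<alpha>. (a \<alpha> + b \<alpha>) * complex_of_real (\<Prod>i\<in>I. x i ^ \<alpha> i)) has_sum (g x + h x))
          {\<alpha>. \<forall>i. i \<notin> I \<longrightarrow> \<alpha> i = 0}" if "\<forall>i\<in>I. \<bar>x i\<bar> < min r s" for x
    using has_sum_add[OF a[of x] b[of x]] that by (simp add: distrib_right)
  then show ?thesis
    unfolding analytic_at_origin_def using r s
    by (intro exI[of _ "min r s"] conjI exI[of _ "\<lambda>\<alpha>. a \<alpha> + b \<alpha>"]) auto
qed

text \<open>A multi-index on the disjoint union is the same as a pair of multi-indices, and its
  monomial is the product of theirs, so no two terms of the product series have to be collected. The
  renaming \<open>\<sigma>\<close> makes the two sets of variables disjoint.\<close>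

lemma analytic_at_origin_mult_disjoint:
  fixes \<sigma> :: "'j \<Rightarrow> 'i"
  assumes fin: "finite I" "finite J" and inj: "inj_on \<sigma> J" and disj: "I \<inter> \<sigma> ` J = {}"
    and "analytic_at_origin I g" "analytic_at_origin J h"
  shows "analytic_at_origin (I \<union> \<sigma> ` J) (\<lambda>x. g x * h (\<lambda>j. x (\<sigma> j)))"
proof -
  obtain r a where r: "r > 0"
    and a: "\<And>x. \<forall>i\<in>I. \<bar>x i\<bar> < r \<Longrightarrow>
      ((\<lambda>\<alpha>. a \<alpha> * complex_of_real (\<Prod>i\<in>I. x i ^ \<alpha> i)) has_sum g x) {\<alpha>. \<forall>i. i \<notin> I \<longrightarrow> \<alpha> i = 0}"
    using assms(5) unfolding analytic_at_origin_def by blast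
  obtain s b where s: "s > 0"
    and b: "\<And>x. \<forall>j\<in>J. \<bar>x j\<bar> < s \<Longrightarrow>
      ((\<lambda>\<beta>. b \<beta> * complex_of_real (\<Prod>j\<in>J. x j ^ \<beta> j)) has_sum h x) {\<beta>. \<forall>j. j \<notin> J \<longrightarrow> \<beta> j = 0}"
    using assms(6) unfolding analytic_at_origin_def by blast
  \<comment> \<open>\<open>left\<close> and \<open>right\<close> restrict a multi-index to the two
    blocks of variables, and \<open>join\<close> glues two of them back. The default 0 keeps the
    results supported in the index sets.\<close>
  define left right where "left \<gamma> = (\<lambda>i. if i \<in> I then \<gamma> i else 0)"
    and "right \<gamma> = (\<lambda>j. if j \<in> J then \<gamma> (\<sigma> j) else 0)" for \<gamma> :: "'i \<Rightarrow> nat"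
  define join where "join \<alpha> \<beta> = (\<lambda>k. if k \<in> I then \<alpha> k
      else if k \<in> \<sigma> ` J then \<beta> (inv_into J \<sigma> k) else 0)" for \<alpha> :: "'i \<Rightarrow> nat" and \<beta> :: "'j \<Rightarrow> nat"
  have notI: "\<sigma> j \<notin> I" if "j \<in> J" for j
    using disj that by auto
  have inv: "inv_into J \<sigma> (\<sigma> j) = j" if "j \<in> J" for j
    using inj that by simp
  have left_join: "left (join \<alpha> \<beta>) = \<alpha>" if "\<forall>i. i \<notin> I \<longrightarrow> \<alpha> i = 0" for \<alpha> \<beta>
    using that by (auto simp: left_def join_def fun_eq_iff)
  have right_join: "right (join \<alpha> \<beta>) = \<beta>" if "\<forall>j. j \<notin> J \<longrightarrow> \<beta> j = 0" for \<alpha> \<beta>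
    using that by (auto simp: right_def join_def fun_eq_iff notI inv)
  have join_split: "join (left \<gamma>) (right \<gamma>) = \<gamma>" if "\<forall>k. k \<notin> I \<union> \<sigma> ` J \<longrightarrow> \<gamma> k = 0" for \<gamma>
    using that by (auto simp: left_def right_def join_def fun_eq_iff notI inv)
  have monomial: "(\<Prod>k\<in>I \<union> \<sigma> ` J. x k ^ \<gamma> k) =
      (\<Prod>i\<in>I. x i ^ left \<gamma> i) * (\<Prod>j\<in>J. x (\<sigma> j) ^ right \<gamma> j)" for x :: "'i \<Rightarrow> real" and \<gamma>
    using fin disj inj by (simp add: prod.union_disjoint prod.reindex left_def right_def)
  have "((\<lambda>\<gamma>. a (left \<gamma>) * b (right \<gamma>) * complex_of_real (\<Prod>k\<in>I \<union> \<sigma> ` J. x k ^ \<gamma> k))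
          has_sum (g x * h (\<lambda>j. x (\<sigma> j)))) {\<gamma>. \<forall>k. k \<notin> I \<union> \<sigma> ` J \<longrightarrow> \<gamma> k = 0}"
    if x: "\<forall>k\<in>I \<union> \<sigma> ` J. \<bar>x k\<bar> < min r s" for x
  proof -
    have sum: "((\<lambda>(\<alpha>, \<beta>). (a \<alpha> * complex_of_real (\<Prod>i\<in>I. x i ^ \<alpha> i)) *
              (b \<beta> * complex_of_real (\<Prod>j\<in>J. x (\<sigma> j) ^ \<beta> j)))
            has_sum (g x * h (\<lambda>j. x (\<sigma> j))))
            ({\<alpha>. \<forall>i. i \<notin> I \<longrightarrow> \<alpha> i = 0} \<times> {\<beta>. \<forall>j. j \<notin> J \<longrightarrow> \<beta> j = 0})"
      using x by (intro has_sum_product a b) auto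
    show ?thesis
      \<comment> \<open>The double series is reindexed along the bijection between multi-indices and
        pairs; \<open>monomial\<close> matches the terms.\<close>
      by (rule iffD2[OF has_sum_reindex_bij_witness[where j = "\<lambda>\<gamma>. (left \<gamma>, right \<gamma>)"
              and i = "\<lambda>(\<alpha>, \<beta>). join \<alpha> \<beta>"] sum])
        (use join_split in \<open>auto simp: left_join right_join monomial mult_ac\<close>,
         auto simp: left_def right_def join_def)
  qed
  then show ?thesis
    unfolding analytic_at_origin_def using r s
    by (intro exI[of _ "min r s"] conjI exI[of _ "\<lambda>\<gamma>. a (left \<gamma>) * b (right \<gamma>)"]) auto
qed

lemma real_analytic_SU2_const: "real_analytic_SU2 n (\<lambda>_. c)"
  by (simp add: real_analytic_SU2_def analytic_at_origin_const)

lemma real_analytic_SU2_add: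
  "real_analytic_SU2 n f \<Longrightarrow> real_analytic_SU2 n f' \<Longrightarrow> real_analytic_SU2 n (\<lambda>g. f g + f' g)"
  by (simp add: real_analytic_SU2_def analytic_at_origin_add)

text \<open>The exponential chart at a point of the larger product is the product of the charts at
  its first \<open>n\<close> and its last \<open>m\<close> components. In it the two factors are
  therefore power series in separate variables.\<close>

lemma real_analytic_SU2_mult_disjoint:
  assumes f: "real_analytic_SU2 n f" and f': "real_analytic_SU2 m f'"
  shows "real_analytic_SU2 (n + m)
    (\<lambda>g. f (\<lambda>k\<in>{..<n}. g k) * f' (\<lambda>k\<in>{..<m}. g (n + k)))"
  unfolding real_analytic_SU2_def
proof
  fix g :: "nat \<Rightarrow> complex^2^2"
  assume g: "g \<in> {..<n + m} \<rightarrow>\<^sub>E SU2"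
  let ?I = "{..<n} \<times> (UNIV :: 3 set)" and ?J = "{..<m} \<times> (UNIV :: 3 set)"
  let ?chart = "\<lambda>n g x. \<lambda>k\<in>{..<n}. g k ** mat_exp (su2_elem (\<chi> i. x (k, i)))"
  let ?g1 = "\<lambda>k\<in>{..<n}. g k" and ?g2 = "\<lambda>k\<in>{..<m}. g (n + k)"
  \<comment> \<open>Shifting the factor index by \<open>n\<close> places the variables of the second
    block after those of the first.\<close>
  define \<sigma> :: "nat \<times> 3 \<Rightarrow> nat \<times> 3" where "\<sigma> = (\<lambda>(k, i). (n + k, i))"
  have "?g1 \<in> {..<n} \<rightarrow>\<^sub>E SU2" "?g2 \<in> {..<m} \<rightarrow>\<^sub>E SU2"
    using g by (auto simp: PiE_def Pi_def)
  then have an: "analytic_at_origin ?I (\<lambda>x. f (?chart n ?g1 x))"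
      "analytic_at_origin ?J (\<lambda>x. f' (?chart m ?g2 x))"
    using f f' unfolding real_analytic_SU2_def by blast+
  have "\<exists>j<m. k = n + j" if "k < n + m" "\<not> k < n" for k
    using that by (intro exI[of _ "k - n"]) auto
  then have union: "{..<n + m} \<times> (UNIV :: 3 set) = ?I \<union> \<sigma> ` ?J"
    unfolding \<sigma>_def by (force simp: image_iff)
  \<comment> \<open>Restricting the large chart to a block gives the chart of that block; outside
    the block both sides are \<open>undefined\<close>.\<close>
  have eqs: "(\<lambda>k\<in>{..<n}. ?chart (n + m) g x k) = ?chart n ?g1 x"
      "(\<lambda>k\<in>{..<m}. ?chart (n + m) g x (n + k)) = ?chart m ?g2 (\<lambda>j. x (\<sigma> j))" for x
    by (auto simp: \<sigma>_def fun_eq_iff restrict_def)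
  have "inj_on \<sigma> ?J" "?I \<inter> \<sigma> ` ?J = {}"
    by (auto simp: \<sigma>_def inj_on_def)
  from analytic_at_origin_mult_disjoint[OF _ _ this an]
  show "analytic_at_origin ({..<n + m} \<times> (UNIV :: 3 set))
      (\<lambda>x. f (\<lambda>k\<in>{..<n}. ?chart (n + m) g x k) * f' (\<lambda>k\<in>{..<m}. ?chart (n + m) g x (n + k)))"
    by (simp only: union eqs) simp
qed

lemma CylI:
  assumes "\<forall>k<n. straight_edge q (\<gamma> k)" "real_analytic_SU2 n f"
  shows "(\<lambda>A. f (\<lambda>k\<in>{..<n}. holonomy A (\<gamma> k))) \<in> Cyl q"
  unfolding Cyl_def using assms by blast

text \<open>The list of edges may be empty.\<close>

lemma Cyl_const: "(\<lambda>_. c) \<in> Cyl q"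
  using CylI[of 0, OF _ real_analytic_SU2_const] by simp

text \<open>The two lists of edges are concatenated. They need not be distinct, so an edge shared by
  both functions may simply occur twice. The nested restrictions present each function as one of a
  block of the joint tuple of holonomies.\<close>

lemma Cyl_common_edges:
  assumes "\<Phi> \<in> Cyl q" "\<Psi> \<in> Cyl q"
  obtains n m \<gamma> f f' where
    "\<forall>k<n + m. straight_edge q (\<gamma> k)" "real_analytic_SU2 n f" "real_analytic_SU2 m f'"
    "\<And>A. \<Phi> A = f (\<lambda>k\<in>{..<n}. (\<lambda>k\<in>{..<n + m}. holonomy A (\<gamma> k)) k)"
    "\<And>A. \<Psi> A = f' (\<lambda>k\<in>{..<m}. (\<lambda>k\<in>{..<n + m}. holonomy A (\<gamma> k)) (n + k))"
proof -
  obtain n \<gamma> f where 1: "\<forall>k<n. straight_edge q (\<gamma> k)" "real_analytic_SU2 n f"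
      "\<And>A. \<Phi> A = f (\<lambda>k\<in>{..<n}. holonomy A (\<gamma> k))"
    using assms(1) unfolding Cyl_def by blast
  obtain m \<delta> f' where 2: "\<forall>k<m. straight_edge q (\<delta> k)" "real_analytic_SU2 m f'"
      "\<And>A. \<Psi> A = f' (\<lambda>k\<in>{..<m}. holonomy A (\<delta> k))"
    using assms(2) unfolding Cyl_def by blast
  show thesis
    by (rule that[of n m "\<lambda>k. if k < n then \<gamma> k else \<delta> (k - n)" f f'])
      (use 1 2 in \<open>auto intro!: arg_cong[where f = f] arg_cong[where f = f']
         simp: fun_eq_iff restrict_def\<close>)
qed

lemma Cyl_mult:
  assumes "\<Phi> \<in> Cyl q" "\<Psi> \<in> Cyl q"
  shows "(\<lambda>A. \<Phi> A * \<Psi> A) \<in> Cyl q"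
proof -
  from assms obtain n m \<gamma> f f' where *:
    "\<forall>k<n + m. straight_edge q (\<gamma> k)" "real_analytic_SU2 n f" "real_analytic_SU2 m f'"
    "\<And>A. \<Phi> A = f (\<lambda>k\<in>{..<n}. (\<lambda>k\<in>{..<n + m}. holonomy A (\<gamma> k)) k)"
    "\<And>A. \<Psi> A = f' (\<lambda>k\<in>{..<m}. (\<lambda>k\<in>{..<n + m}. holonomy A (\<gamma> k)) (n + k))"
    by (rule Cyl_common_edges) blast
  show ?thesis
    unfolding *(4,5) using CylI[OF *(1) real_analytic_SU2_mult_disjoint[OF *(2,3)]] .
qed

lemma Cyl_add:
  assumes "\<Phi> \<in> Cyl q" "\<Psi> \<in> Cyl q"
  shows "(\<lambda>A. \<Phi> A + \<Psi> A) \<in> Cyl q"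
proof -
  from assms obtain n m \<gamma> f f' where *:
    "\<forall>k<n + m. straight_edge q (\<gamma> k)" "real_analytic_SU2 n f" "real_analytic_SU2 m f'"
    "\<And>A. \<Phi> A = f (\<lambda>k\<in>{..<n}. (\<lambda>k\<in>{..<n + m}. holonomy A (\<gamma> k)) k)"
    "\<And>A. \<Psi> A = f' (\<lambda>k\<in>{..<m}. (\<lambda>k\<in>{..<n + m}. holonomy A (\<gamma> k)) (n + k))"
    by (rule Cyl_common_edges) blast
  \<comment> \<open>Each summand becomes a function of all \<open>n + m\<close> holonomies by
    multiplying it with the constant 1 on the other block.\<close>
  have "real_analytic_SU2 (n + m)
      (\<lambda>g. f (\<lambda>k\<in>{..<n}. g k) + f' (\<lambda>k\<in>{..<m}. g (n + k)))"
    using real_analytic_SU2_add[OF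
        real_analytic_SU2_mult_disjoint[OF *(2) real_analytic_SU2_const[of m 1]]
        real_analytic_SU2_mult_disjoint[OF real_analytic_SU2_const[of n 1] *(3)]]
    by simp
  from CylI[OF *(1) this] show ?thesis
    unfolding *(4,5) .
qed

lemma Cyl_scale: "\<Phi> \<in> Cyl q \<Longrightarrow> (\<lambda>A. a * \<Phi> A) \<in> Cyl q"
  by (rule Cyl_mult[OF Cyl_const])

text \<open>Linearity comes from that of \<open>pull_back\<close>. Closure of \<open>Cyl q\<close>
  under sums and multiples enters because functionals are extensional: at those arguments too the
  embedding must take its proper value, not \<open>undefined\<close>.\<close>

lemma c_embedding_in_algebraic_dual:
  assumes "\<psi> \<in> algebraic_dual (Cyl_S q A0)"
  shows "c_embedding q A0 \<psi> \<in> algebraic_dual (Cyl q)"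
proof -
  have "pull_back A0 \<Phi> \<in> Cyl_S q A0" if "\<Phi> \<in> Cyl q" for \<Phi>
    using that by (simp add: Cyl_S_def)
  moreover have "pull_back A0 (\<lambda>A. \<Phi> A + \<Psi> A) = (\<lambda>c. pull_back A0 \<Phi> c + pull_back A0 \<Psi> c)"
      "pull_back A0 (\<lambda>A. a * \<Phi> A) = (\<lambda>c. a * pull_back A0 \<Phi> c)" for \<Phi> \<Psi> a
    by (simp_all add: pull_back_def o_def)
  ultimately show ?thesis
    using assms by (simp add: algebraic_dual_def c_embedding_def Cyl_add Cyl_scale)
qed

text \<open>Multiplication by \<open>F\<close> is a linear map of \<open>Cyl q\<close> into itself,
  so \<open>\<psi>\<close> can be composed with it.\<close>

lemma mult_op_dual_in_algebraic_dual:
  assumes F: "F \<in> Cyl q" and \<psi>: "\<psi> \<in> algebraic_dual (Cyl q)"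
  shows "dual_action (Cyl q) (mult_op F) \<psi> \<in> algebraic_dual (Cyl q)"
proof -
  have "mult_op F \<Phi> \<in> Cyl q" if "\<Phi> \<in> Cyl q" for \<Phi>
    using Cyl_mult[OF F that] by (simp add: mult_op_def)
  moreover have "mult_op F (\<lambda>A. \<Phi> A + \<Psi> A) = (\<lambda>A. mult_op F \<Phi> A + mult_op F \<Psi> A)"
      "mult_op F (\<lambda>A. a * \<Phi> A) = (\<lambda>A. a * mult_op F \<Phi> A)" for \<Phi> \<Psi> a
    by (simp_all add: mult_op_def algebra_simps)
  ultimately show ?thesis
    using \<psi> by (simp add: algebraic_dual_def dual_action_def Cyl_add Cyl_scale)
qed

lemma c_embedding_intertwines:
  assumes "F \<in> Cyl q"
  shows "dual_action (Cyl q) (mult_op F) (c_embedding q A0 \<psi>) =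
    c_embedding q A0 (dual_action (Cyl_S q A0) (mult_op (F \<circ> symm_conn A0)) \<psi>)"
proof
  fix \<Phi>
  \<comment> \<open>The left side evaluates the embedded functional at the product, where it is
    given by \<open>\<psi>\<close> only if the product is cylindrical.\<close>
  have "mult_op F \<Phi> \<in> Cyl q" if "\<Phi> \<in> Cyl q"
    using Cyl_mult[OF assms that] by (simp add: mult_op_def)
  moreover have "pull_back A0 (mult_op F \<Phi>) = mult_op (F \<circ> symm_conn A0) (pull_back A0 \<Phi>)"
    by (simp add: pull_back_def mult_op_def o_def)
  ultimately show "dual_action (Cyl q) (mult_op F) (c_embedding q A0 \<psi>) \<Phi> =
      c_embedding q A0 (dual_action (Cyl_S q A0) (mult_op (F \<circ> symm_conn A0)) \<psi>) \<Phi>"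
    by (simp add: dual_action_def c_embedding_def Cyl_S_def)
qed

theorem proposition2:
  fixes A0 :: connection
    and l :: real
    and e q :: "real^3 \<Rightarrow> real^3^3"
    and F :: "connection \<Rightarrow> complex"
  assumes "A0 \<in> invariant_connections" and "A0 \<noteq> 0"
    and "l > 0"
    and "\<And>p. connection_form A0 p ** e p = mat (1 / l)"
    and "q = triad_metric e"
    and "F \<in> Cyl q"
  shows
    "compose (algebraic_dual (Cyl_S q A0))
        (dual_action (Cyl q) (mult_op F)) (c_embedding q A0)
      \<in> algebraic_dual (Cyl_S q A0) \<rightarrow>\<^sub>E algebraic_dual (Cyl q) \<and>
     compose (algebraic_dual (Cyl_S q A0))
        (dual_action (Cyl q) (mult_op F)) (c_embedding q A0)
      = compose (algebraic_dual (Cyl_S q A0))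
          (c_embedding q A0) (dual_action (Cyl_S q A0) (mult_op (F \<circ> symm_conn A0)))"
  \<comment> \<open>Both composites are restricted to the dual of \<open>Cyl_S q A0\<close>, so
    their equality reduces to the identity for each functional. The left composite lands in the dual
    of \<open>Cyl q\<close> since the embedding does and multiplication by \<open>F\<close>
    preserves it.\<close>
  using assms(6)
  by (auto simp: compose_def c_embedding_intertwines[symmetric]
      intro!: mult_op_dual_in_algebraic_dual c_embedding_in_algebraic_dual)

end
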